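(* Let $X$ be a random variable with values in a measurable space $\mathcal X$ and let $W=\varphi(X)$ with $\varphi:\mathcal X\to\mathbb R$ measurable, $\mathbb E\{W\}=0$ and $\mathbb E\{W^2\}=1$. Let $(X,X')$ be an exchangeable pair, let $F:\mathcal X\times\mathcal X\to\mathbb R$ be an antisymmetric measurable function, and suppose that $D:=F(X,X')$ is integrable and satisfies $$\mathbb E\{D\mid X\}=\lambda(W+R)$$ for a constant $\lambda>0$ and a random variable $R$. Let $W'=\varphi(X')$ and $\Delta=W-W'$. Let $F^*:\mathcal X\times\mathcal X\to\mathbb R$ be any symmetric measurable function such that $D^*:=F^*(X,X')\ge|D|$ and $D^*\Delta$ is integrable. Then $$\sup_{z\in\mathbb R}\bigl|\mathbb P[W\le z]-\Phi(z)\bigr|\le \mathbb E\left|1-\frac1{2\lambda}\mathbb E\{D\Delta\mid W\}\right|+\frac1\lambda\,\mathbb E\bigl|\mathbb E\{D^*\Delta\mid W\}\bigr|+\mathbb E|R|.$$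
   Context: $(X,X')$ is exchangeable if $(X,X')$ and $(X',X)$ have the same distribution. $F$ is antisymmetric if $F(x,x')=-F(x',x)$ and $F^*$ is symmetric if $F^*(x,x')=F^*(x',x)$. $\Phi$ is the standard normal distribution function. *)

theory Defs
  imports "HOL-Probability.Probability"
begin

definition exchangeable_pair ::
  "'w measure \<Rightarrow> 'x measure \<Rightarrow> ('w \<Rightarrow> 'x) \<Rightarrow> ('w \<Rightarrow> 'x) \<Rightarrow> bool" where
  "exchangeable_pair M N X X' \<longleftrightarrow>
     X \<in> measurable M N \<and> X' \<in> measurable M N \<and>
     distr M (N \<Otimes>\<^sub>M N) (\<lambda>\<omega>. (X \<omega>, X' \<omega>)) = distr M (N \<Otimes>\<^sub>M N) (\<lambda>\<omega>. (X' \<omega>, X \<omega>))"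

definition antisymmetric_on :: "'x set \<Rightarrow> ('x \<Rightarrow> 'x \<Rightarrow> real) \<Rightarrow> bool" where
  "antisymmetric_on S F \<longleftrightarrow> (\<forall>x\<in>S. \<forall>y\<in>S. F x y = - F y x)"

definition symmetric_on :: "'x set \<Rightarrow> ('x \<Rightarrow> 'x \<Rightarrow> real) \<Rightarrow> bool" where
  "symmetric_on S F \<longleftrightarrow> (\<forall>x\<in>S. \<forall>y\<in>S. F x y = F y x)"

(* A version of E{Y | Z}, where Z takes values in the measurable space N: conditional
   expectation with respect to the sigma-algebra generated by Z. It is determined only up to
   null sets, so identities involving it must be stated almost everywhere. *)
definition cond_exp_given ::
  "'w measure \<Rightarrow> 'z measure \<Rightarrow> ('w \<Rightarrow> real) \<Rightarrow> ('w \<Rightarrow> 'z) \<Rightarrow> 'w \<Rightarrow> real" where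
  "cond_exp_given M N Y Z = real_cond_exp M (vimage_algebra (space M) Z N) Y"

end

theory Submission
  imports Defs "HOL-Real_Asymp.Real_Asymp"
begin

text \<open>
  Stein's method. Let \<open>f\<close> be the bounded solution of \<open>f' w - w * f w = 1{w \<le> z} - \<Phi> z\<close>; then
  \<open>P (W \<le> z) - \<Phi> z = E (f' W - W * f W)\<close>, and conditioning on \<open>X\<close> turns \<open>E (W * f W)\<close> into
  \<open>E (D * f W) / lam - E (R * f W)\<close>. By antisymmetry, \<open>2 * E (D * f W) = E (D * (f W - f W'))\<close>.
  Since \<open>f' = w * f w + 1{w \<le> z} - \<Phi> z\<close> is the sum of an increasing and a decreasing function,
  replacing \<open>f W - f W'\<close> by \<open>\<Delta> * (f' W + f' W') / 2\<close> costs at most \<open>\<Delta> * (k W - k W') / 2\<close>,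
  where \<open>k w = w * f w - 1{w \<le> z}\<close> is increasing. Exchangeability turns the main term into
  \<open>E (D * \<Delta> * f' W)\<close> and the error, after \<open>\<bar>D\<bar> \<le> Ds\<close>, into \<open>E (Ds * \<Delta> * k W)\<close>;
  both are estimated by conditioning on \<open>W\<close>, using \<open>\<bar>f'\<bar> \<le> 1\<close> and \<open>\<bar>k\<bar> \<le> 2\<close>.
\<close>

subsection \<open>The normal distribution function and Mills' ratio\<close>

abbreviation \<Phi> :: "real \<Rightarrow> real" where
  "\<Phi> \<equiv> cdf std_normal_distribution"

lemma DERIV_std_normal_density:
  "(std_normal_density has_real_derivative - x * std_normal_density x) (at x)"
proof -
  have "((\<lambda>x. c * exp (- x\<^sup>2 / 2)) has_real_derivative - x * (c * exp (- x\<^sup>2 / 2))) (at x)" for c :: real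
    by (auto intro!: derivative_eq_intros)
  then show ?thesis
    by (simp only: std_normal_density_def[abs_def])
qed

lemma std_normal_cdf_diff:
  assumes "a \<le> b"
  shows "\<Phi> b - \<Phi> a = integral {a..b} std_normal_density"
proof -
  interpret real_distribution std_normal_distribution
    by (rule real_dist_normal_dist)
  have "\<Phi> b - \<Phi> a = measure std_normal_distribution {a<..b}"
    using assms by (cases "a = b") (simp_all add: cdf_diff_eq)
  also have "\<dots> = integral\<^sup>L std_normal_distribution (indicator {a<..b})"
    by simp
  also have "\<dots> = (LINT x:{a<..b}|lborel. std_normal_density x)"
    by (subst integral_density) (auto simp: set_lebesgue_integral_def mult.commute)
  also have "\<dots> = integral {a<..b} std_normal_density"
    using integrable_mult_indicator[of "{a<..b}" lborel std_normal_density]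
    by (intro set_borel_integral_eq_integral) (simp add: set_integrable_def)
  also have "\<dots> = integral {a..b} std_normal_density"
    by (rule integral_spike_set; rule negligible_subset[of "{a}"]) auto
  finally show ?thesis .
qed

lemma DERIV_std_normal_cdf:
  "(\<Phi> has_real_derivative std_normal_density x) (at x)"
proof -
  have cont: "continuous_on {x-1..x+1} std_normal_density"
    by (intro DERIV_atLeastAtMost_imp_continuous_on exI) (rule DERIV_std_normal_density)
  have "((\<lambda>t. \<Phi> (x-1) + integral {x-1..t} std_normal_density) has_real_derivative std_normal_density x)
          (at x within {x-1..x+1})"
    by (auto intro!: derivative_eq_intros integral_has_real_derivative cont)
  then have "(\<Phi> has_real_derivative std_normal_density x) (at x within {x-1..x+1})"
  proof (rule has_field_derivative_transform_within[OF _ zero_less_one])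
    fix t assume "t \<in> {x-1..x+1}"
    then show "\<Phi> (x-1) + integral {x-1..t} std_normal_density = \<Phi> t"
      using std_normal_cdf_diff[of "x-1" t] by simp
  qed simp
  moreover have "at x within {x-1..x+1} = at x"
    by (rule at_within_interior) simp
  ultimately show ?thesis by simp
qed

lemma std_normal_cdf_lims: "(\<Phi> \<longlongrightarrow> 0) at_bot" "(\<Phi> \<longlongrightarrow> 1) at_top"
proof -
  interpret real_distribution std_normal_distribution
    by (rule real_dist_normal_dist)
  show "(\<Phi> \<longlongrightarrow> 0) at_bot" "(\<Phi> \<longlongrightarrow> 1) at_top"
    by (rule cdf_lim_at_bot, rule cdf_lim_at_top_prob)
qed

lemma std_normal_cdf_bounds: "0 \<le> \<Phi> x" "\<Phi> x \<le> 1"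
proof -
  interpret real_distribution std_normal_distribution
    by (rule real_dist_normal_dist)
  show "0 \<le> \<Phi> x" "\<Phi> x \<le> 1"
    by (rule cdf_nonneg, rule cdf_bounded_prob)
qed

lemma std_normal_cdf_mono: "x \<le> y \<Longrightarrow> \<Phi> x \<le> \<Phi> y"
proof -
  interpret real_distribution std_normal_distribution
    by (rule real_dist_normal_dist)
  show "x \<le> y \<Longrightarrow> \<Phi> x \<le> \<Phi> y"
    by (rule cdf_nondecreasing)
qed

lemma std_normal_density_even: "std_normal_density (- x) = std_normal_density x"
  by (simp add: std_normal_density_def)

text \<open>The derivative of \<open>\<Phi> y + \<Phi> (- y)\<close> vanishes because the density is
  even; the constant value is read off from the limit at infinity.\<close>

lemma std_normal_cdf_minus: "\<Phi> (- x) = 1 - \<Phi> x"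
proof -
  have const: "\<Phi> y + \<Phi> (- y) = \<Phi> x + \<Phi> (- x)" for y
  proof (rule DERIV_isconst_all[where f = "\<lambda>y. \<Phi> y + \<Phi> (- y)"], rule allI)
    fix x
    show "((\<lambda>y. \<Phi> y + \<Phi> (- y)) has_real_derivative 0) (at x)"
      by (auto intro!: derivative_eq_intros DERIV_std_normal_cdf
            DERIV_chain2[where f = \<Phi> and g = uminus] simp: std_normal_density_even)
  qed
  have "((\<lambda>y. \<Phi> (- y)) \<longlongrightarrow> 0) at_top"
    using std_normal_cdf_lims(1) by (simp add: filterlim_at_bot_mirror)
  then have "((\<lambda>y. \<Phi> y + \<Phi> (- y)) \<longlongrightarrow> 1 + 0) at_top"
    by (intro tendsto_add std_normal_cdf_lims)
  moreover have "(\<lambda>y. \<Phi> y + \<Phi> (- y)) = (\<lambda>y. \<Phi> x + \<Phi> (- x))"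
    by (rule ext) (rule const)
  ultimately have "((\<lambda>y. \<Phi> x + \<Phi> (- x)) \<longlongrightarrow> 1) (at_top :: real filter)"
    by simp
  then show ?thesis
    by (simp add: tendsto_const_iff)
qed

text \<open>A function that starts from the limit 0 at minus infinity and does not decrease up to
  \<open>b\<close> is nonnegative at \<open>b\<close>. The three tail inequalities below all follow
  this pattern.\<close>

lemma nonneg_if_DERIV_nonneg_at_bot:
  fixes h :: "real \<Rightarrow> real"
  assumes deriv: "\<And>x. x \<le> b \<Longrightarrow> (h has_real_derivative h' x) (at x)"
    and nonneg: "\<And>x. x \<le> b \<Longrightarrow> 0 \<le> h' x"
    and lim: "(h \<longlongrightarrow> 0) at_bot"
  shows "0 \<le> h b"
proof -
  have "h x \<le> h b" if "x \<le> b" for x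
    by (rule DERIV_nonneg_imp_nondecreasing[OF that]) (use deriv nonneg in blast)
  then show ?thesis
    by (intro tendsto_upperbound[OF lim]) (auto simp: eventually_at_bot_linorder)
qed

text \<open>Mills' ratio for the lower tail: \<open>normal_ratio (- w)\<close> is the classical
  ratio of the upper tail probability at \<open>w\<close> to the density at
  \<open>w\<close>.\<close>

definition normal_ratio :: "real \<Rightarrow> real" where
  "normal_ratio w = \<Phi> w / std_normal_density w"

lemma normal_ratio_nonneg: "0 \<le> normal_ratio w"
  by (simp add: normal_ratio_def std_normal_cdf_bounds)

lemma std_normal_density_lim: "((\<lambda>x. std_normal_density x) \<longlongrightarrow> 0) at_bot"
  unfolding std_normal_density_def by real_asymp

text \<open>For negative \<open>w\<close> this is the classical upper tail bound, density divided by
  the modulus of \<open>w\<close>. After division by \<open>- w\<close> the gap has derivative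
  density over \<open>x\<^sup>2\<close>, and it vanishes at minus infinity.\<close>

lemma mills_upper: "0 \<le> w * \<Phi> w + std_normal_density w"
proof (cases "w < 0")
  case True
  have "0 \<le> - std_normal_density w / w - \<Phi> w"
  proof (rule nonneg_if_DERIV_nonneg_at_bot[where h = "\<lambda>x. - std_normal_density x / x - \<Phi> x"
        and h' = "\<lambda>x. std_normal_density x / x\<^sup>2"])
    fix x :: real assume "x \<le> w"
    with True show "((\<lambda>x. - std_normal_density x / x - \<Phi> x) has_real_derivative
        std_normal_density x / x\<^sup>2) (at x)"
      by (auto intro!: derivative_eq_intros DERIV_std_normal_density DERIV_std_normal_cdf
            simp: field_simps power2_eq_square)
    show "0 \<le> std_normal_density x / x\<^sup>2" by simp
  next
    have "((\<lambda>x. - std_normal_density x / x) \<longlongrightarrow> 0) at_bot"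
      unfolding std_normal_density_def by real_asymp
    from tendsto_diff[OF this std_normal_cdf_lims(1)]
    show "((\<lambda>x. - std_normal_density x / x - \<Phi> x) \<longlongrightarrow> 0) at_bot" by simp
  qed
  with True show ?thesis by (simp add: field_simps)
qed (simp add: std_normal_cdf_bounds)

text \<open>The companion lower bound on the tail. It is exactly what makes
  \<open>w * normal_ratio w\<close> increasing.\<close>

lemma mills_lower: "0 \<le> \<Phi> w + w * std_normal_density w / (1 + w\<^sup>2)"
proof (rule nonneg_if_DERIV_nonneg_at_bot[where h = "\<lambda>x. \<Phi> x + x * std_normal_density x / (1 + x\<^sup>2)"
      and h' = "\<lambda>x. 2 * std_normal_density x / (1 + x\<^sup>2)\<^sup>2"])
  fix x :: real
  have "1 + x\<^sup>2 \<noteq> 0" by (metis add_pos_nonneg less_irrefl zero_le_power2 zero_less_one)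
  then show "((\<lambda>x. \<Phi> x + x * std_normal_density x / (1 + x\<^sup>2)) has_real_derivative
      2 * std_normal_density x / (1 + x\<^sup>2)\<^sup>2) (at x)"
    by (auto intro!: derivative_eq_intros DERIV_std_normal_density DERIV_std_normal_cdf)
       (simp add: divide_simps; simp add: algebra_simps power2_eq_square)
  show "0 \<le> 2 * std_normal_density x / (1 + x\<^sup>2)\<^sup>2" by simp
next
  have "((\<lambda>x. x * std_normal_density x / (1 + x\<^sup>2)) \<longlongrightarrow> 0) at_bot"
    unfolding std_normal_density_def by real_asymp
  from tendsto_add[OF std_normal_cdf_lims(1) this]
  show "((\<lambda>x. \<Phi> x + x * std_normal_density x / (1 + x\<^sup>2)) \<longlongrightarrow> 0) at_bot" by simp
qed

text \<open>By reflection \<open>w \<le> 0\<close> may be assumed. There the gap has derivative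
  density times \<open>2 * \<Phi> x - 1 - x\<close>; this factor is 0 at the origin and
  nonincreasing, as twice the density is at most 1, so it is nonnegative to the left of 0.\<close>

lemma std_normal_cdf_mult_compl_le: "\<Phi> w * (1 - \<Phi> w) \<le> std_normal_density w"
proof -
  have half: "\<Phi> 0 = 1 / 2"
    using std_normal_cdf_minus[of 0] by simp
  have dens: "std_normal_density x * 2 \<le> 1" for x
  proof -
    have "2 \<le> sqrt (2 * pi)"
      using pi_ge_two by (intro real_le_rsqrt) simp
    moreover have "exp (- x\<^sup>2 / 2) \<le> 1" by simp
    ultimately have "2 * exp (- x\<^sup>2 / 2) \<le> sqrt (2 * pi)" by linarith
    then show ?thesis
      unfolding std_normal_density_def by (simp add: divide_simps)
  qed
  have neg: "\<Phi> w * (1 - \<Phi> w) \<le> std_normal_density w" if "w \<le> 0" for w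
  proof -
    have "0 \<le> std_normal_density w - \<Phi> w * (1 - \<Phi> w)"
    proof (rule nonneg_if_DERIV_nonneg_at_bot[where h = "\<lambda>x. std_normal_density x - \<Phi> x * (1 - \<Phi> x)"
          and h' = "\<lambda>x. std_normal_density x * (2 * \<Phi> x - 1 - x)"])
      fix x assume "x \<le> w"
      show "((\<lambda>x. std_normal_density x - \<Phi> x * (1 - \<Phi> x)) has_real_derivative
          std_normal_density x * (2 * \<Phi> x - 1 - x)) (at x)"
        by (auto intro!: derivative_eq_intros DERIV_std_normal_density DERIV_std_normal_cdf
              simp: algebra_simps)
      have "x \<le> 0" using \<open>x \<le> w\<close> that by simp
      then have "2 * \<Phi> 0 - 1 - 0 \<le> 2 * \<Phi> x - 1 - x"
        by (rule DERIV_nonpos_imp_nonincreasing[where f = "\<lambda>x. 2 * \<Phi> x - 1 - x"])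
           (auto intro!: derivative_eq_intros DERIV_std_normal_cdf exI simp: dens)
      then show "0 \<le> std_normal_density x * (2 * \<Phi> x - 1 - x)"
        by (simp add: half)
    next
      have "((\<lambda>x. std_normal_density x - \<Phi> x * (1 - \<Phi> x)) \<longlongrightarrow> 0 - 0 * (1 - 0)) at_bot"
        by (intro tendsto_intros std_normal_density_lim std_normal_cdf_lims)
      then show "((\<lambda>x. std_normal_density x - \<Phi> x * (1 - \<Phi> x)) \<longlongrightarrow> 0) at_bot" by simp
    qed
    then show ?thesis by simp
  qed
  show ?thesis
    using neg[of w] neg[of "- w"] by (cases "w \<le> 0")
      (auto simp: std_normal_cdf_minus std_normal_density_even mult.commute)
qed

text \<open>Thus \<open>g = normal_ratio\<close> solves \<open>g' w - w * g w = 1\<close>, so its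
  multiples solve Stein's equation wherever the right-hand side is constant.\<close>

lemma DERIV_normal_ratio:
  "(normal_ratio has_real_derivative 1 + w * normal_ratio w) (at w)"
proof -
  have "std_normal_density w \<noteq> 0"
    using normal_density_pos[of 1 0 w] by simp
  then show ?thesis
    unfolding normal_ratio_def[abs_def]
    by (auto intro!: derivative_eq_intros DERIV_std_normal_density DERIV_std_normal_cdf
          simp: field_simps)
qed

lemma DERIV_normal_ratio_minus:
  "((\<lambda>w. normal_ratio (- w)) has_real_derivative - (1 + - w * normal_ratio (- w))) (at w)"
  using DERIV_chain2[OF DERIV_normal_ratio DERIV_minus[OF DERIV_ident], of w UNIV] by simp

lemma mult_normal_ratio_ge: "- 1 \<le> w * normal_ratio w"
proof -
  have "0 < std_normal_density w" by (simp add: normal_density_pos)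
  then show ?thesis
    using mills_upper[of w] by (simp add: normal_ratio_def field_simps)
qed

text \<open>The derivative times the density is
  \<open>(1 + x\<^sup>2) * \<Phi> x + x * std_normal_density x\<close>, which is nonnegative by
  \<open>mills_lower\<close>.\<close>

lemma mult_normal_ratio_mono:
  assumes "v \<le> w"
  shows "v * normal_ratio v \<le> w * normal_ratio w"
proof (rule DERIV_nonneg_imp_nondecreasing[OF assms], intro exI conjI)
  fix x :: real
  show "((\<lambda>w. w * normal_ratio w) has_real_derivative
      normal_ratio x + x * (1 + x * normal_ratio x)) (at x)"
    by (auto intro!: derivative_eq_intros DERIV_normal_ratio)
  have "0 < std_normal_density x" "0 < 1 + x\<^sup>2"
    by (simp_all add: normal_density_pos add_pos_nonneg)
  moreover from this have "0 \<le> (1 + x\<^sup>2) * \<Phi> x + x * std_normal_density x"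
    using mills_lower[of x] by (simp add: divide_simps mult.commute split: if_splits)
  ultimately show "0 \<le> normal_ratio x + x * (1 + x * normal_ratio x)"
    by (simp add: normal_ratio_def field_simps power2_eq_square)
qed

lemma normal_ratio_mult_compl_le: "normal_ratio w * (1 - \<Phi> w) \<le> 1"
proof -
  have "0 < std_normal_density w" by (simp add: normal_density_pos)
  then show ?thesis
    using std_normal_cdf_mult_compl_le[of w] by (simp add: normal_ratio_def field_simps)
qed

subsection \<open>The solution of Stein's equation\<close>

text \<open>The left branch satisfies Stein's equation with right-hand side
  \<open>1 - \<Phi> z\<close>, the right branch with \<open>- \<Phi> z\<close>. The factors are
  chosen so that the branches agree at \<open>z\<close>.\<close>

definition stein :: "real \<Rightarrow> real \<Rightarrow> real" where
  "stein z w = (if w \<le> z then normal_ratio w * (1 - \<Phi> z) else normal_ratio (- w) * \<Phi> z)"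

text \<open>Reflection exchanges the two branches, so bounds proved to the left of \<open>z\<close>
  transfer to the right.\<close>

lemma stein_minus: "w \<noteq> z \<Longrightarrow> stein z w = stein (- z) (- w)"
  by (auto simp: stein_def std_normal_cdf_minus)

text \<open>By continuity at the kink, the right branch can be used on the closed half-line.\<close>

lemma stein_right: "z \<le> w \<Longrightarrow> stein z w = normal_ratio (- w) * \<Phi> z"
  by (auto simp: stein_def normal_ratio_def std_normal_cdf_minus std_normal_density_even mult.commute)

lemma stein_nonneg: "0 \<le> stein z w"
  by (simp add: stein_def normal_ratio_nonneg std_normal_cdf_bounds)

text \<open>To the left of \<open>z\<close>, the factor \<open>1 - \<Phi> z\<close> is at most
  \<open>1 - \<Phi> w\<close>, which leaves the product bounded in
  \<open>normal_ratio_mult_compl_le\<close>.\<close>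

lemma stein_le_1: "stein z w \<le> 1"
proof -
  have left: "stein z w \<le> 1" if "w \<le> z" for z w
  proof -
    have "stein z w \<le> normal_ratio w * (1 - \<Phi> w)"
      using that by (auto simp: stein_def intro!: mult_left_mono std_normal_cdf_mono normal_ratio_nonneg)
    then show ?thesis
      using normal_ratio_mult_compl_le[of w] by simp
  qed
  show ?thesis
    using left[of w z] left[of "- w" "- z"] stein_minus[of w z] by (cases "w \<le> z") auto
qed

text \<open>On the left branch the lower bound is \<open>mult_normal_ratio_ge\<close>. Reflection
  changes the sign of \<open>w * stein z w\<close> and so interchanges the two bounds.\<close>

lemma mult_stein_bounds:
  "\<Phi> z - 1 \<le> w * stein z w \<and> w * stein z w \<le> \<Phi> z"
proof -
  have left: "\<Phi> z - 1 \<le> w * stein z w \<and> w * stein z w \<le> \<Phi> z" if "w \<le> z" for z w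
  proof
    have "(1 - \<Phi> z) * (- 1) \<le> (1 - \<Phi> z) * (w * normal_ratio w)"
      by (intro mult_left_mono mult_normal_ratio_ge) (simp add: std_normal_cdf_bounds)
    then show "\<Phi> z - 1 \<le> w * stein z w"
      using that by (simp add: stein_def mult_ac)
    show "w * stein z w \<le> \<Phi> z"
    proof (cases "0 \<le> w")
      case True
      \<comment> \<open>Once \<open>z\<close> is replaced by \<open>w\<close> in the second factor,
        the product of ratio and tail can be regrouped as
        \<open>\<Phi> w * normal_ratio (- w)\<close>, and Mills' bound at \<open>- w\<close>
        applies.\<close>
      have "w * stein z w \<le> w * (normal_ratio w * (1 - \<Phi> w))"
        using that True
        by (auto simp: stein_def intro!: mult_left_mono std_normal_cdf_mono normal_ratio_nonneg)
      also have "\<dots> = \<Phi> w * (w * normal_ratio (- w))"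
        by (simp add: normal_ratio_def std_normal_cdf_minus std_normal_density_even)
      also have "\<dots> \<le> \<Phi> w * 1"
        using mult_normal_ratio_ge[of "- w"]
        by (intro mult_left_mono) (simp_all add: std_normal_cdf_bounds)
      also have "\<dots> \<le> \<Phi> z"
        using that by (simp add: std_normal_cdf_mono)
      finally show ?thesis .
    next
      case False
      then have "w * stein z w \<le> 0"
        by (intro mult_nonpos_nonneg stein_nonneg) simp
      then show ?thesis
        using std_normal_cdf_bounds(1)[of z] by linarith
    qed
  qed
  show ?thesis
    using left[of w z] left[of "- w" "- z"] stein_minus[of w z]
    by (cases "w \<le> z") (auto simp: std_normal_cdf_minus)
qed

lemma mult_stein_mono:
  assumes "v \<le> w"
  shows "v * stein z v \<le> w * stein z w"
proof -
  have left: "v * stein z v \<le> w * stein z w" if "v \<le> w" "w \<le> z" for v w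
    using mult_right_mono[OF mult_normal_ratio_mono[OF that(1)], of "1 - \<Phi> z"] that
    by (simp add: stein_def std_normal_cdf_bounds mult_ac)
  have right: "v * stein z v \<le> w * stein z w" if "v \<le> w" "z \<le> v" for v w
    using mult_right_mono[OF mult_normal_ratio_mono[of "- w" "- v"], of "\<Phi> z"] that
    by (simp add: stein_right std_normal_cdf_bounds mult_ac)
  show ?thesis
    using left[of v w] right[of v w] left[of v z] right[of z w] assms by linarith
qed

text \<open>The derivative of \<open>stein z\<close>, read off from Stein's equation; at the kink \<open>w = z\<close> it is
  the left derivative.\<close>

definition stein' :: "real \<Rightarrow> real \<Rightarrow> real" where
  "stein' z w = w * stein z w + indicator {..z} w - \<Phi> z"

text \<open>By \<open>mult_stein_bounds\<close> the derivative lies in [0, 1] to the left of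
  \<open>z\<close> and in [-1, 0] to the right.\<close>

lemma abs_stein'_le_1: "\<bar>stein' z w\<bar> \<le> 1"
proof (cases "w \<le> z")
  case True
  then show ?thesis
    using mult_stein_bounds[of z w] std_normal_cdf_bounds[of z] by (auto simp: stein'_def)
next
  case False
  then show ?thesis
    using mult_stein_bounds[of z w] std_normal_cdf_bounds[of z] by (auto simp: stein'_def)
qed

text \<open>On one side of the kink the mean value theorem applies, and the slope at the
  intermediate point lies between the endpoint slopes because \<open>w * stein z w\<close> is
  increasing.\<close>

lemma stein_diff_bounds_left:
  assumes "a \<le> b" "b \<le> z"
  shows "(b - a) * (a * stein z a + 1 - \<Phi> z) \<le> stein z b - stein z a \<and>
         stein z b - stein z a \<le> (b - a) * (b * stein z b + 1 - \<Phi> z)"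
proof (cases "a = b")
  case False
  with assms have "a < b" by simp
  have "\<exists>c>a. c < b \<and> normal_ratio b * (1 - \<Phi> z) - normal_ratio a * (1 - \<Phi> z)
       = (b - a) * ((1 + c * normal_ratio c) * (1 - \<Phi> z))"
    using \<open>a < b\<close> by (rule MVT2) (intro DERIV_cmult_right DERIV_normal_ratio)
  then obtain c where c: "a < c" "c < b"
    and "normal_ratio b * (1 - \<Phi> z) - normal_ratio a * (1 - \<Phi> z)
       = (b - a) * ((1 + c * normal_ratio c) * (1 - \<Phi> z))" by blast
  then have "stein z b - stein z a = (b - a) * (c * stein z c + 1 - \<Phi> z)"
    using assms by (simp add: stein_def algebra_simps)
  then show ?thesis
    using c assms by (auto intro!: mult_left_mono mult_stein_mono)
qed simp

lemma stein_diff_bounds_right: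
  assumes "a \<le> b" "z \<le> a"
  shows "(b - a) * (a * stein z a - \<Phi> z) \<le> stein z b - stein z a \<and>
         stein z b - stein z a \<le> (b - a) * (b * stein z b - \<Phi> z)"
proof (cases "a = b")
  case False
  with assms have "a < b" by simp
  have "\<exists>c>a. c < b \<and> normal_ratio (- b) * \<Phi> z - normal_ratio (- a) * \<Phi> z
       = (b - a) * (- (1 + - c * normal_ratio (- c)) * \<Phi> z)"
    using \<open>a < b\<close> by (rule MVT2) (intro DERIV_cmult_right DERIV_normal_ratio_minus)
  then obtain c where c: "a < c" "c < b"
    and "normal_ratio (- b) * \<Phi> z - normal_ratio (- a) * \<Phi> z
       = (b - a) * (- (1 + - c * normal_ratio (- c)) * \<Phi> z)" by blast
  then have "stein z b - stein z a = (b - a) * (c * stein z c - \<Phi> z)"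
    using assms by (simp add: stein_right algebra_simps)
  then show ?thesis
    using c assms by (auto intro!: mult_left_mono mult_stein_mono)
qed simp

text \<open>The slope is an increasing term plus the decreasing indicator. Taking each term at the
  endpoint where it is smallest (largest) gives the lower (upper) bound, hence the mixed
  endpoints.\<close>

lemma stein_diff_bounds:
  assumes "a \<le> b"
  shows "(b - a) * (a * stein z a + indicator {..z} b - \<Phi> z) \<le> stein z b - stein z a \<and>
         stein z b - stein z a \<le> (b - a) * (b * stein z b + indicator {..z} a - \<Phi> z)"
proof -
  consider "b \<le> z" | "z < a" | "a \<le> z" "z < b" by linarith
  then show ?thesis
  proof cases
    case 1
    then show ?thesis using stein_diff_bounds_left[of a b z] assms by auto
  next
    case 2
    then show ?thesis using stein_diff_bounds_right[of a b z] assms by auto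
  next
    case 3
    \<comment> \<open>With the kink inside, the one-sided bounds on the intervals from
      \<open>a\<close> to \<open>z\<close> and from \<open>z\<close> to \<open>b\<close> are added;
      \<open>low\<close> and \<open>up\<close> first weaken them to a common slope.\<close>
    have low: "(b - z) * (a * stein z a - \<Phi> z) \<le> (b - z) * (z * stein z z - \<Phi> z)"
      "(z - a) * (a * stein z a - \<Phi> z) \<le> (z - a) * (a * stein z a + 1 - \<Phi> z)"
      and up: "(z - a) * (z * stein z z + 1 - \<Phi> z) \<le> (z - a) * (b * stein z b + 1 - \<Phi> z)"
      "(b - z) * (b * stein z b - \<Phi> z) \<le> (b - z) * (b * stein z b + 1 - \<Phi> z)"
      using 3 by (auto intro!: mult_left_mono mult_stein_mono)
    have split: "(b - a) * x = (z - a) * x + (b - z) * x" for x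
      by (simp add: algebra_simps)
    have "indicator {..z} a = (1::real)" "indicator {..z} b = (0::real)"
      using 3 by auto
    then show ?thesis
      using low up split[of "a * stein z a - \<Phi> z"] split[of "b * stein z b + 1 - \<Phi> z"]
        stein_diff_bounds_left[of a z z] stein_diff_bounds_right[of z b z] 3
      by (smt (verit))
  qed
qed

text \<open>The trapezoidal rule, rather than a one-sided rule, is what gives the constant
  \<open>1 / lam\<close> instead of \<open>2 / lam\<close> in the theorem.\<close>

definition stein_osc :: "real \<Rightarrow> real \<Rightarrow> real" where
  "stein_osc z w = w * stein z w - indicator {..z} w"

text \<open>The trapezoidal value is the midpoint of the two bounds in
  \<open>stein_diff_bounds\<close>, and the right-hand side is half their distance. Exchanging
  \<open>a\<close> and \<open>b\<close> flips the sign inside the modulus and preserves the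
  right-hand side.\<close>

lemma stein_trapezoid:
  "\<bar>stein z a - stein z b - (a - b) * (stein' z a + stein' z b) / 2\<bar>
     \<le> (a - b) * (stein_osc z a - stein_osc z b) / 2"
proof -
  have *: "\<bar>stein z b - stein z a - (b - a) * (stein' z a + stein' z b) / 2\<bar>
     \<le> (b - a) * (stein_osc z b - stein_osc z a) / 2" if "a \<le> b" for a b
  proof -
    define l where "l = (b - a) * (a * stein z a + indicator {..z} b - \<Phi> z)"
    define u where "u = (b - a) * (b * stein z b + indicator {..z} a - \<Phi> z)"
    have eqs: "(b - a) * (stein' z a + stein' z b) = l + u"
      "(b - a) * (stein_osc z b - stein_osc z a) = u - l"
      by (simp_all add: l_def u_def stein'_def stein_osc_def algebra_simps)
    have "l \<le> stein z b - stein z a" "stein z b - stein z a \<le> u"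
      using stein_diff_bounds[OF that, of z] by (simp_all add: l_def u_def)
    then show ?thesis
      unfolding eqs by (auto simp: abs_le_iff field_simps)
  qed
  show ?thesis
  proof (cases "a \<le> b")
    case True
    have "stein z a - stein z b - (a - b) * (stein' z a + stein' z b) / 2
        = - (stein z b - stein z a - (b - a) * (stein' z a + stein' z b) / 2)"
      "(a - b) * (stein_osc z a - stein_osc z b) = (b - a) * (stein_osc z b - stein_osc z a)"
      by (simp_all add: field_simps)
    then show ?thesis
      using *[OF True] by (simp only: abs_minus_cancel)
  next
    case False
    then show ?thesis using *[of b a] by (simp add: add.commute)
  qed
qed

lemma abs_stein_osc_le_2: "\<bar>stein_osc z w\<bar> \<le> 2"
  using mult_stein_bounds[of z w] std_normal_cdf_bounds[of z]
  by (auto simp: stein_osc_def indicator_def)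

section \<open>Measurability of the Stein solution and its companions\<close>

lemma borel_measurable_normal_ratio [measurable]: "normal_ratio \<in> borel_measurable borel"
  by (intro borel_measurable_continuous_onI DERIV_continuous_on)
     (use DERIV_normal_ratio in \<open>auto intro: has_field_derivative_at_within\<close>)

lemma borel_measurable_stein [measurable]: "stein z \<in> borel_measurable borel"
  unfolding stein_def[abs_def] by measurable

lemma borel_measurable_stein' [measurable]: "stein' z \<in> borel_measurable borel"
  unfolding stein'_def[abs_def] by measurable

lemma borel_measurable_stein_osc [measurable]: "stein_osc z \<in> borel_measurable borel"
  unfolding stein_osc_def[abs_def] by measurable

subsection \<open>Exchangeable pairs and conditional expectations\<close>

text \<open>Both sides are integrals of \<open>G\<close> against the same law on the product space;
  if \<open>G\<close> is not integrable there, both take the default value 0.\<close>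

lemma exchangeable_pair_swap:
  fixes G :: "'x \<Rightarrow> 'x \<Rightarrow> real"
  assumes "exchangeable_pair M N X X'"
    and [measurable]: "(\<lambda>(x, y). G x y) \<in> borel_measurable (N \<Otimes>\<^sub>M N)"
  shows "(\<integral>\<omega>. G (X' \<omega>) (X \<omega>) \<partial>M) = (\<integral>\<omega>. G (X \<omega>) (X' \<omega>) \<partial>M)"
proof -
  have [measurable]: "X \<in> measurable M N" "X' \<in> measurable M N"
    and eq: "distr M (N \<Otimes>\<^sub>M N) (\<lambda>\<omega>. (X \<omega>, X' \<omega>)) = distr M (N \<Otimes>\<^sub>M N) (\<lambda>\<omega>. (X' \<omega>, X \<omega>))"
    using assms(1) by (auto simp: exchangeable_pair_def)
  have "(\<integral>\<omega>. G (X' \<omega>) (X \<omega>) \<partial>M)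
      = (\<integral>p. (\<lambda>(x, y). G x y) p \<partial>distr M (N \<Otimes>\<^sub>M N) (\<lambda>\<omega>. (X' \<omega>, X \<omega>)))"
    by (subst integral_distr) auto
  also have "\<dots> = (\<integral>p. (\<lambda>(x, y). G x y) p \<partial>distr M (N \<Otimes>\<^sub>M N) (\<lambda>\<omega>. (X \<omega>, X' \<omega>)))"
    by (simp only: eq)
  also have "\<dots> = (\<integral>\<omega>. G (X \<omega>) (X' \<omega>) \<partial>M)"
    by (subst integral_distr) auto
  finally show ?thesis .
qed

lemma integrable_bounded_mult:
  fixes Y g :: "'w \<Rightarrow> real"
  assumes "integrable M Y" and [measurable]: "g \<in> borel_measurable M"
    and "\<And>\<omega>. \<bar>g \<omega>\<bar> \<le> C"
  shows "integrable M (\<lambda>\<omega>. g \<omega> * Y \<omega>)"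
proof (rule Bochner_Integration.integrable_bound)
  show "integrable M (\<lambda>\<omega>. C * Y \<omega>)" using assms(1) by simp
  show "(\<lambda>\<omega>. g \<omega> * Y \<omega>) \<in> borel_measurable M"
    using assms(1) by measurable
  have "\<bar>g \<omega>\<bar> \<le> \<bar>C\<bar>" for \<omega> using assms(3)[of \<omega>] by linarith
  then show "AE \<omega> in M. norm (g \<omega> * Y \<omega>) \<le> norm (C * Y \<omega>)"
    by (simp add: abs_mult mult_right_mono)
qed

lemma sigma_finite_subalgebra_vimage_algebra:
  assumes "prob_space M" and Z: "Z \<in> measurable M N"
  shows "sigma_finite_subalgebra M (vimage_algebra (space M) Z N)"
proof -
  interpret prob_space M by fact
  have "sets (vimage_algebra (space M) Z N) \<subseteq> sets M"
    using Z measurable_space[OF Z]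
    by (auto simp: sets_vimage_algebra2 Pi_iff)
  then have "finite_measure_subalgebra M (vimage_algebra (space M) Z N)"
    by (unfold_locales) (simp add: subalgebra_def)
  then show ?thesis
    by (rule finite_measure_subalgebra_is_sigma_finite)
qed

lemma integrable_cond_exp_given:
  assumes "prob_space M" "Z \<in> measurable M N" "integrable M Y"
  shows "integrable M (cond_exp_given M N Y Z)"
  unfolding cond_exp_given_def
  by (intro sigma_finite_subalgebra.real_cond_exp_int sigma_finite_subalgebra_vimage_algebra assms)

text \<open>The factor \<open>g (Z \<omega>)\<close> is measurable for the sigma-algebra generated
  by \<open>Z\<close>, and its boundedness keeps the product integrable, so it passes through the
  conditional expectation.\<close>

lemma integral_mult_cond_exp_given:
  assumes "prob_space M" and Z [measurable]: "Z \<in> measurable M N" and Y: "integrable M Y"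
    and g [measurable]: "g \<in> borel_measurable N" and bounded: "\<And>x. \<bar>g x\<bar> \<le> C"
  shows "(\<integral>\<omega>. g (Z \<omega>) * cond_exp_given M N Y Z \<omega> \<partial>M) = (\<integral>\<omega>. g (Z \<omega>) * Y \<omega> \<partial>M)"
  unfolding cond_exp_given_def
proof (rule sigma_finite_subalgebra.real_cond_exp_intg(2))
  show "sigma_finite_subalgebra M (vimage_algebra (space M) Z N)"
    by (rule sigma_finite_subalgebra_vimage_algebra) fact+
  show "integrable M (\<lambda>\<omega>. g (Z \<omega>) * Y \<omega>)"
    by (rule integrable_bounded_mult[OF Y _ bounded]) measurable
  have "Z \<in> measurable (vimage_algebra (space M) Z N) N"
    using measurable_space[OF Z] by (intro measurable_vimage_algebra1) auto
  then show "(\<lambda>\<omega>. g (Z \<omega>)) \<in> borel_measurable (vimage_algebra (space M) Z N)"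
    by measurable
  show "Y \<in> borel_measurable M" using Y by simp
qed

lemma abs_integral_mult_le:
  fixes g Y :: "'w \<Rightarrow> real"
  assumes Y: "integrable M Y" and [measurable]: "g \<in> borel_measurable M"
    and bounded: "\<And>\<omega>. \<bar>g \<omega>\<bar> \<le> C"
  shows "\<bar>\<integral>\<omega>. g \<omega> * Y \<omega> \<partial>M\<bar> \<le> C * (\<integral>\<omega>. \<bar>Y \<omega>\<bar> \<partial>M)"
proof -
  have "\<bar>\<integral>\<omega>. g \<omega> * Y \<omega> \<partial>M\<bar> \<le> (\<integral>\<omega>. \<bar>g \<omega> * Y \<omega>\<bar> \<partial>M)"
    by (rule integral_abs_bound)
  also have "\<dots> \<le> (\<integral>\<omega>. C * \<bar>Y \<omega>\<bar> \<partial>M)"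
  proof (rule integral_mono)
    show "integrable M (\<lambda>\<omega>. \<bar>g \<omega> * Y \<omega>\<bar>)"
      by (intro integrable_abs integrable_bounded_mult[OF Y _ bounded]) measurable
  qed (use Y bounded in \<open>auto simp: abs_mult mult_right_mono\<close>)
  finally show ?thesis by simp
qed

section \<open>The normal approximation bound for exchangeable pairs\<close>

theorem theorem4p1:
  fixes M :: "'w measure" and N :: "'x measure"
    and X X' :: "'w \<Rightarrow> 'x"
    and \<phi> :: "'x \<Rightarrow> real"
    and F Fs :: "'x \<Rightarrow> 'x \<Rightarrow> real"
    and W W' \<Delta> D Ds R :: "'w \<Rightarrow> real"
    and lam :: real
  assumes "prob_space M"
    and "exchangeable_pair M N X X'"
    and "\<phi> \<in> borel_measurable N"
    and "W = (\<lambda>\<omega>. \<phi> (X \<omega>))"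
    and "W' = (\<lambda>\<omega>. \<phi> (X' \<omega>))"
    and "\<Delta> = (\<lambda>\<omega>. W \<omega> - W' \<omega>)"
    and "integrable M W" and "(\<integral>\<omega>. W \<omega> \<partial>M) = 0"
    and "integrable M (\<lambda>\<omega>. (W \<omega>)\<^sup>2)" and "(\<integral>\<omega>. (W \<omega>)\<^sup>2 \<partial>M) = 1"
    and "(\<lambda>(x, y). F x y) \<in> borel_measurable (N \<Otimes>\<^sub>M N)"
    and "antisymmetric_on (space N) F"
    and "D = (\<lambda>\<omega>. F (X \<omega>) (X' \<omega>))"
    and "integrable M D"
    and "lam > 0"
    and "R \<in> borel_measurable M"
    and "AE \<omega> in M. cond_exp_given M N D X \<omega> = lam * (W \<omega> + R \<omega>)"
    and "(\<lambda>(x, y). Fs x y) \<in> borel_measurable (N \<Otimes>\<^sub>M N)"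
    and "symmetric_on (space N) Fs"
    and "Ds = (\<lambda>\<omega>. Fs (X \<omega>) (X' \<omega>))"
    and "AE \<omega> in M. Ds \<omega> \<ge> \<bar>D \<omega>\<bar>"
    and "integrable M (\<lambda>\<omega>. Ds \<omega> * \<Delta> \<omega>)"
  shows "(SUP z. \<bar>\<P>(\<omega> in M. W \<omega> \<le> z) - cdf std_normal_distribution z\<bar>)
    \<le> (\<integral>\<omega>. \<bar>1 - 1 / (2 * lam) * cond_exp_given M borel (\<lambda>\<omega>. D \<omega> * \<Delta> \<omega>) W \<omega>\<bar> \<partial>M)
      + 1 / lam * (\<integral>\<omega>. \<bar>cond_exp_given M borel (\<lambda>\<omega>. Ds \<omega> * \<Delta> \<omega>) W \<omega>\<bar> \<partial>M)
      + (\<integral>\<omega>. \<bar>R \<omega>\<bar> \<partial>M)"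
proof (rule cSUP_least)
  \<comment> \<open>The right-hand side is free of \<open>z\<close>, so it suffices to bound the
    distance at each fixed \<open>z\<close>.\<close>
  fix z
  interpret prob_space M by fact
  note defs = assms(4-6,13,20)
  note exch = assms(2)
  have X [measurable]: "X \<in> measurable M N" and X' [measurable]: "X' \<in> measurable M N"
    using exch by (auto simp: exchangeable_pair_def)
  note [measurable] = assms(3,11,16,18)
  have X_space: "\<omega> \<in> space M \<Longrightarrow> X \<omega> \<in> space N" "\<omega> \<in> space M \<Longrightarrow> X' \<omega> \<in> space N" for \<omega>
    by (rule measurable_space[OF X] measurable_space[OF X'], assumption)+
  have F_swap: "\<omega> \<in> space M \<Longrightarrow> F (X' \<omega>) (X \<omega>) = - F (X \<omega>) (X' \<omega>)"
    and Fs_swap: "\<omega> \<in> space M \<Longrightarrow> Fs (X' \<omega>) (X \<omega>) = Fs (X \<omega>) (X' \<omega>)" for \<omega>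
    using assms(12,19) X_space unfolding antisymmetric_on_def symmetric_on_def by blast+
  have W [measurable]: "W \<in> borel_measurable M" and W' [measurable]: "W' \<in> borel_measurable M"
    unfolding defs by measurable
  have [measurable]: "D \<in> borel_measurable M" using assms(14) by simp
  have [measurable]: "\<Delta> \<in> borel_measurable M" unfolding assms(6) by measurable

  have int_DsDelta: "integrable M (\<lambda>\<omega>. Ds \<omega> * \<Delta> \<omega>)" by fact
  have int_DDelta: "integrable M (\<lambda>\<omega>. D \<omega> * \<Delta> \<omega>)"
  proof (rule Bochner_Integration.integrable_bound[OF int_DsDelta])
    show "AE \<omega> in M. norm (D \<omega> * \<Delta> \<omega>) \<le> norm (Ds \<omega> * \<Delta> \<omega>)"
      using assms(21) by eventually_elim (auto simp: abs_mult intro!: mult_right_mono)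
  qed measurable
  \<comment> \<open>Integrability of \<open>R\<close> is recovered from the regression identity;
    without it the integral of its modulus would be the default 0 and could bound nothing.\<close>
  have int_R: "integrable M R"
  proof -
    have "integrable M (\<lambda>\<omega>. cond_exp_given M N D X \<omega> / lam - W \<omega>)"
      using integrable_cond_exp_given[OF assms(1) X assms(14)] assms(7) by simp
    then show ?thesis
    proof (rule integrable_cong_AE_imp)
      show "AE \<omega> in M. cond_exp_given M N D X \<omega> / lam - W \<omega> = R \<omega>"
        using assms(17) by eventually_elim (use \<open>lam > 0\<close> in simp)
    qed measurable
  qed

  let ?f = "stein z" and ?s = "stein' z" and ?k = "stein_osc z"
  let ?U = "cond_exp_given M borel (\<lambda>\<omega>. D \<omega> * \<Delta> \<omega>) W"
  let ?V = "cond_exp_given M borel (\<lambda>\<omega>. Ds \<omega> * \<Delta> \<omega>) W"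
  have f_bound: "\<bar>?f w\<bar> \<le> 1" for w
    using stein_nonneg[of z w] stein_le_1[of z w] by simp
  have int_U: "integrable M ?U" and int_V: "integrable M ?V"
    by (intro integrable_cond_exp_given assms(1) W int_DDelta int_DsDelta)+
  have ints:
    "integrable M (\<lambda>\<omega>. ?f (W \<omega>) * D \<omega>)" "integrable M (\<lambda>\<omega>. ?f (W' \<omega>) * D \<omega>)"
    "integrable M (\<lambda>\<omega>. ?f (W \<omega>) * W \<omega>)" "integrable M (\<lambda>\<omega>. ?f (W \<omega>) * R \<omega>)"
    by (rule integrable_bounded_mult[OF _ _ f_bound]; use assms(7,14) int_R in simp)+
  have ints':
    "integrable M (\<lambda>\<omega>. ?s (W \<omega>) * (D \<omega> * \<Delta> \<omega>))" "integrable M (\<lambda>\<omega>. ?s (W' \<omega>) * (D \<omega> * \<Delta> \<omega>))"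
    "integrable M (\<lambda>\<omega>. ?s (W \<omega>) * ?U \<omega>)" "integrable M (\<lambda>\<omega>. ?s (W \<omega>) * 1)"
    by (rule integrable_bounded_mult[OF _ _ abs_stein'_le_1]; use int_DDelta int_U in simp)+
  have intk:
    "integrable M (\<lambda>\<omega>. ?k (W \<omega>) * (Ds \<omega> * \<Delta> \<omega>))" "integrable M (\<lambda>\<omega>. ?k (W' \<omega>) * (Ds \<omega> * \<Delta> \<omega>))"
    by (rule integrable_bounded_mult[OF _ _ abs_stein_osc_le_2]; use int_DsDelta in simp)+

  \<comment> \<open>The test function is \<open>stein z\<close> composed with \<open>\<phi>\<close>,
    a bounded function of \<open>X\<close>, so \<open>D\<close> may be replaced by its conditional
    expectation given \<open>X\<close>.\<close>
  have Df: "(\<integral>\<omega>. ?f (W \<omega>) * D \<omega> \<partial>M)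
      = lam * ((\<integral>\<omega>. ?f (W \<omega>) * W \<omega> \<partial>M) + (\<integral>\<omega>. ?f (W \<omega>) * R \<omega> \<partial>M))"
  proof -
    have "(\<integral>\<omega>. ?f (W \<omega>) * D \<omega> \<partial>M) = (\<integral>\<omega>. ?f (\<phi> (X \<omega>)) * cond_exp_given M N D X \<omega> \<partial>M)"
      unfolding assms(4)
      by (rule integral_mult_cond_exp_given[OF assms(1) X assms(14) _ f_bound, symmetric]) measurable
    also have "\<dots> = (\<integral>\<omega>. lam * (?f (W \<omega>) * W \<omega> + ?f (W \<omega>) * R \<omega>) \<partial>M)"
    proof (rule integral_cong_AE)
      show "AE \<omega> in M. ?f (\<phi> (X \<omega>)) * cond_exp_given M N D X \<omega>
          = lam * (?f (W \<omega>) * W \<omega> + ?f (W \<omega>) * R \<omega>)"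
        using assms(17) by eventually_elim (simp add: assms(4) algebra_simps)
      show "(\<lambda>\<omega>. ?f (\<phi> (X \<omega>)) * cond_exp_given M N D X \<omega>) \<in> borel_measurable M"
        using integrable_cond_exp_given[OF assms(1) X assms(14)] by measurable
    qed measurable
    finally show ?thesis using ints by simp
  qed

  have swap_f: "(\<integral>\<omega>. ?f (W' \<omega>) * D \<omega> \<partial>M) = - (\<integral>\<omega>. ?f (W \<omega>) * D \<omega> \<partial>M)"
  proof -
    have "(\<integral>\<omega>. ?f (W' \<omega>) * D \<omega> \<partial>M) = (\<integral>\<omega>. ?f (\<phi> (X \<omega>)) * F (X' \<omega>) (X \<omega>) \<partial>M)"
      unfolding defs
      by (rule exchangeable_pair_swap[OF exch, of "\<lambda>x y. ?f (\<phi> y) * F x y", symmetric]) measurable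
    also have "\<dots> = (\<integral>\<omega>. - (?f (W \<omega>) * D \<omega>) \<partial>M)"
      by (rule Bochner_Integration.integral_cong) (simp_all add: defs F_swap)
    finally show ?thesis by simp
  qed
  \<comment> \<open>Under the swap both \<open>D\<close> and \<open>\<Delta>\<close> change sign, so
    their product is invariant; in \<open>swap_k\<close> only \<open>\<Delta>\<close> changes
    sign.\<close>
  have swap_s: "(\<integral>\<omega>. ?s (W' \<omega>) * (D \<omega> * \<Delta> \<omega>) \<partial>M) = (\<integral>\<omega>. ?s (W \<omega>) * (D \<omega> * \<Delta> \<omega>) \<partial>M)"
  proof -
    have "(\<integral>\<omega>. ?s (W' \<omega>) * (D \<omega> * \<Delta> \<omega>) \<partial>M)
        = (\<integral>\<omega>. ?s (\<phi> (X \<omega>)) * (F (X' \<omega>) (X \<omega>) * (\<phi> (X' \<omega>) - \<phi> (X \<omega>))) \<partial>M)"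
      unfolding defs
      by (rule exchangeable_pair_swap[OF exch, of "\<lambda>x y. ?s (\<phi> y) * (F x y * (\<phi> x - \<phi> y))", symmetric])
         measurable
    also have "\<dots> = (\<integral>\<omega>. ?s (W \<omega>) * (D \<omega> * \<Delta> \<omega>) \<partial>M)"
      by (rule Bochner_Integration.integral_cong) (simp_all add: defs F_swap algebra_simps)
    finally show ?thesis .
  qed
  have swap_k: "(\<integral>\<omega>. ?k (W' \<omega>) * (Ds \<omega> * \<Delta> \<omega>) \<partial>M) = - (\<integral>\<omega>. ?k (W \<omega>) * (Ds \<omega> * \<Delta> \<omega>) \<partial>M)"
  proof -
    have "(\<integral>\<omega>. ?k (W' \<omega>) * (Ds \<omega> * \<Delta> \<omega>) \<partial>M)
        = (\<integral>\<omega>. ?k (\<phi> (X \<omega>)) * (Fs (X' \<omega>) (X \<omega>) * (\<phi> (X' \<omega>) - \<phi> (X \<omega>))) \<partial>M)"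
      unfolding defs
      by (rule exchangeable_pair_swap[OF exch, of "\<lambda>x y. ?k (\<phi> y) * (Fs x y * (\<phi> x - \<phi> y))", symmetric])
         measurable
    also have "\<dots> = (\<integral>\<omega>. - (?k (W \<omega>) * (Ds \<omega> * \<Delta> \<omega>)) \<partial>M)"
      by (rule Bochner_Integration.integral_cong) (simp_all add: defs Fs_swap algebra_simps)
    finally show ?thesis by simp
  qed

  have trapezoid: "\<bar>2 * (\<integral>\<omega>. ?f (W \<omega>) * D \<omega> \<partial>M) - (\<integral>\<omega>. ?s (W \<omega>) * (D \<omega> * \<Delta> \<omega>) \<partial>M)\<bar>
      \<le> (\<integral>\<omega>. ?k (W \<omega>) * (Ds \<omega> * \<Delta> \<omega>) \<partial>M)"
  proof -
    \<comment> \<open>\<open>?e\<close> is \<open>D\<close> times the trapezoidal error and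
      \<open>?b\<close> its pointwise bound. The swap identities turn their integrals into the two
      sides of the claim.\<close>
    let ?e = "\<lambda>\<omega>. (?f (W \<omega>) * D \<omega> - ?f (W' \<omega>) * D \<omega>)
          - (?s (W \<omega>) * (D \<omega> * \<Delta> \<omega>) + ?s (W' \<omega>) * (D \<omega> * \<Delta> \<omega>)) / 2"
    let ?b = "\<lambda>\<omega>. (?k (W \<omega>) * (Ds \<omega> * \<Delta> \<omega>) - ?k (W' \<omega>) * (Ds \<omega> * \<Delta> \<omega>)) / 2"
    have "\<bar>\<integral>\<omega>. ?e \<omega> \<partial>M\<bar> \<le> (\<integral>\<omega>. \<bar>?e \<omega>\<bar> \<partial>M)"
      using integral_norm_bound[of M ?e] by simp
    also have "\<dots> \<le> (\<integral>\<omega>. ?b \<omega> \<partial>M)"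
    proof (rule integral_mono_AE)
      show "AE \<omega> in M. \<bar>?e \<omega>\<bar> \<le> ?b \<omega>"
        using assms(21)
      proof eventually_elim
        fix \<omega> assume Ds: "\<bar>D \<omega>\<bar> \<le> Ds \<omega>"
        let ?t = "?f (W \<omega>) - ?f (W' \<omega>) - \<Delta> \<omega> * (?s (W \<omega>) + ?s (W' \<omega>)) / 2"
        have "\<bar>?e \<omega>\<bar> = \<bar>D \<omega>\<bar> * \<bar>?t\<bar>"
          by (subst abs_mult[symmetric]) (simp add: algebra_simps add_divide_distrib)
        \<comment> \<open>The factor with \<open>?k\<close> is nonnegative since it dominates the
          modulus of the trapezoidal error, so the two bounds can be multiplied.\<close>
        also have "\<dots> \<le> Ds \<omega> * (\<Delta> \<omega> * (?k (W \<omega>) - ?k (W' \<omega>)) / 2)"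
          using stein_trapezoid[of z "W \<omega>" "W' \<omega>"] Ds
          by (intro mult_mono) (auto simp: assms(6))
        also have "\<dots> = ?b \<omega>" by (simp add: algebra_simps diff_divide_distrib)
        finally show "\<bar>?e \<omega>\<bar> \<le> ?b \<omega>" .
      qed
    qed (use ints ints' intk in auto)
    also have "\<dots> = (\<integral>\<omega>. ?k (W \<omega>) * (Ds \<omega> * \<Delta> \<omega>) \<partial>M)"
      using intk swap_k by simp
    also have "(\<integral>\<omega>. ?e \<omega> \<partial>M)
        = 2 * (\<integral>\<omega>. ?f (W \<omega>) * D \<omega> \<partial>M) - (\<integral>\<omega>. ?s (W \<omega>) * (D \<omega> * \<Delta> \<omega>) \<partial>M)"
      using ints ints' swap_f swap_s by simp
    finally show ?thesis .
  qed

  have k_V: "(\<integral>\<omega>. ?k (W \<omega>) * (Ds \<omega> * \<Delta> \<omega>) \<partial>M) \<le> 2 * (\<integral>\<omega>. \<bar>?V \<omega>\<bar> \<partial>M)"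
  proof -
    have "(\<integral>\<omega>. ?k (W \<omega>) * (Ds \<omega> * \<Delta> \<omega>) \<partial>M) = (\<integral>\<omega>. ?k (W \<omega>) * ?V \<omega> \<partial>M)"
      by (rule integral_mult_cond_exp_given[OF assms(1) W int_DsDelta _ abs_stein_osc_le_2, symmetric])
         measurable
    also have "\<dots> \<le> 2 * (\<integral>\<omega>. \<bar>?V \<omega>\<bar> \<partial>M)"
      using abs_integral_mult_le[OF int_V, of "\<lambda>\<omega>. ?k (W \<omega>)" 2] abs_stein_osc_le_2
      by (simp add: abs_le_iff)
    finally show ?thesis .
  qed

  have s_U: "\<bar>(\<integral>\<omega>. ?s (W \<omega>) \<partial>M) - 1 / (2 * lam) * (\<integral>\<omega>. ?s (W \<omega>) * (D \<omega> * \<Delta> \<omega>) \<partial>M)\<bar>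
      \<le> (\<integral>\<omega>. \<bar>1 - 1 / (2 * lam) * ?U \<omega>\<bar> \<partial>M)"
  proof -
    have "(\<integral>\<omega>. ?s (W \<omega>) * (D \<omega> * \<Delta> \<omega>) \<partial>M) = (\<integral>\<omega>. ?s (W \<omega>) * ?U \<omega> \<partial>M)"
      by (rule integral_mult_cond_exp_given[OF assms(1) W int_DDelta _ abs_stein'_le_1, symmetric])
         measurable
    then have "(\<integral>\<omega>. ?s (W \<omega>) \<partial>M) - 1 / (2 * lam) * (\<integral>\<omega>. ?s (W \<omega>) * (D \<omega> * \<Delta> \<omega>) \<partial>M)
        = (\<integral>\<omega>. ?s (W \<omega>) * 1 - 1 / (2 * lam) * (?s (W \<omega>) * ?U \<omega>) \<partial>M)"
      using ints' by (subst Bochner_Integration.integral_diff) simp_all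
    also have "\<dots> = (\<integral>\<omega>. ?s (W \<omega>) * (1 - 1 / (2 * lam) * ?U \<omega>) \<partial>M)"
      by (simp add: algebra_simps)
    finally show ?thesis
      using abs_integral_mult_le[of M "\<lambda>\<omega>. 1 - 1 / (2 * lam) * ?U \<omega>" "\<lambda>\<omega>. ?s (W \<omega>)" 1]
        int_U abs_stein'_le_1 by simp
  qed

  have f_R: "\<bar>\<integral>\<omega>. ?f (W \<omega>) * R \<omega> \<partial>M\<bar> \<le> (\<integral>\<omega>. \<bar>R \<omega>\<bar> \<partial>M)"
    using abs_integral_mult_le[OF int_R, of "\<lambda>\<omega>. ?f (W \<omega>)" 1] f_bound by simp

  \<comment> \<open>Stein's equation is evaluated at \<open>W \<omega>\<close> and
    integrated.\<close>
  have "\<P>(\<omega> in M. W \<omega> \<le> z) - \<Phi> z = (\<integral>\<omega>. indicator {\<omega> \<in> space M. W \<omega> \<le> z} \<omega> - \<Phi> z \<partial>M)"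
    by (subst Bochner_Integration.integral_diff) (auto simp: prob_space emeasure_eq_measure)
  also have "\<dots> = (\<integral>\<omega>. ?s (W \<omega>) * 1 - ?f (W \<omega>) * W \<omega> \<partial>M)"
    by (rule Bochner_Integration.integral_cong) (auto simp: stein'_def indicator_def)
  also have "\<dots> = (\<integral>\<omega>. ?s (W \<omega>) \<partial>M) - (\<integral>\<omega>. ?f (W \<omega>) * W \<omega> \<partial>M)"
    using ints ints' by (subst Bochner_Integration.integral_diff) simp_all
  also have "(\<integral>\<omega>. ?f (W \<omega>) * W \<omega> \<partial>M)
      = 1 / (2 * lam) * (2 * (\<integral>\<omega>. ?f (W \<omega>) * D \<omega> \<partial>M)) - (\<integral>\<omega>. ?f (W \<omega>) * R \<omega> \<partial>M)"
    using Df \<open>lam > 0\<close> by (simp add: field_simps)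
  \<comment> \<open>The term with \<open>D * \<Delta>\<close> is subtracted and added back,
    separating the parts controlled by \<open>s_U\<close>, by \<open>trapezoid\<close> with
    \<open>k_V\<close>, and by \<open>f_R\<close>.\<close>
  finally have stein_identity: "\<P>(\<omega> in M. W \<omega> \<le> z) - \<Phi> z
      = ((\<integral>\<omega>. ?s (W \<omega>) \<partial>M) - 1 / (2 * lam) * (\<integral>\<omega>. ?s (W \<omega>) * (D \<omega> * \<Delta> \<omega>) \<partial>M))
        - 1 / (2 * lam) * (2 * (\<integral>\<omega>. ?f (W \<omega>) * D \<omega> \<partial>M) - (\<integral>\<omega>. ?s (W \<omega>) * (D \<omega> * \<Delta> \<omega>) \<partial>M))
        + (\<integral>\<omega>. ?f (W \<omega>) * R \<omega> \<partial>M)"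
    by (simp add: algebra_simps)
  \<comment> \<open>The bound 2 on \<open>stein_osc\<close> cancels the 2 in
    \<open>1 / (2 * lam)\<close>.\<close>
  have "\<bar>1 / (2 * lam) * (2 * (\<integral>\<omega>. ?f (W \<omega>) * D \<omega> \<partial>M) - (\<integral>\<omega>. ?s (W \<omega>) * (D \<omega> * \<Delta> \<omega>) \<partial>M))\<bar>
      \<le> 1 / (2 * lam) * (2 * (\<integral>\<omega>. \<bar>?V \<omega>\<bar> \<partial>M))"
    unfolding abs_mult using trapezoid k_V \<open>lam > 0\<close> by (intro mult_mono) auto
  also have "\<dots> = 1 / lam * (\<integral>\<omega>. \<bar>?V \<omega>\<bar> \<partial>M)" by simp
  finally show "\<bar>\<P>(\<omega> in M. W \<omega> \<le> z) - \<Phi> z\<bar>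
    \<le> (\<integral>\<omega>. \<bar>1 - 1 / (2 * lam) * ?U \<omega>\<bar> \<partial>M) + 1 / lam * (\<integral>\<omega>. \<bar>?V \<omega>\<bar> \<partial>M) + (\<integral>\<omega>. \<bar>R \<omega>\<bar> \<partial>M)"
    unfolding stein_identity using s_U f_R by linarith
qed simp

end
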